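(* Let $Y$, $\mathcal P=(P_n)$ and the operator classes $S(Y)$, $M(Y)$, $SN(Y)$ be as in the context. Suppose $A = C + K$, where $C\in L(Y)$ is invertible with $C^{-1}\in S(Y)$, and $K\in S(Y)\cap M(Y)$. Suppose further that there exist $B\in L(Y)$ and $T_1,T_2\in SN(Y)$ such that $AB = I + T_1$ and $BA = I + T_2$. Then $A$ is Fredholm.
   Context: $Y$ is a real or complex Banach space with norm $\|\cdot\|$, $L(Y)$ is the set of bounded linear operators on $Y$, $I$ the identity. $\mathcal P=(P_n)_{n=0}^\infty\subset L(Y)$ satisfies: (i) $\sup_n\|P_nx\|=\|x\|$ for all $x\in Y$; (ii) for every $m\in\mathbb N_0$ there is $N(m)\ge m$ with $P_nP_m=P_m=P_mP_n$ for all $n\ge N(m)$. Put $|x|_n:=\max_{0\le m\le n}\|P_mx\|$. The strict topology on $Y$ is the locally convex topology generated by the seminorms $|x|_a:=\sup_n a(n)|x|_n$, $a:\mathbb N_0\to(0,\infty)$ running through all positive null sequences. Sequential convergence $x_n\stackrel{s}{\to}x$ in this topology holds iff $\sup_n\|x_n\|<\infty$ and $\|P_m(x_n-x)\|\to0$ as $n\to\infty$ for every $m$. $S(Y)$ is the set of linear operators $A$ on $Y$ that are sequentially continuous in the strict topology ($x_n\stackrel{s}{\to}x\Rightarrow Ax_n\stackrel{s}{\to}Ax$). $SN(Y)$ is the set of linear operators with $x_n\stackrel{s}{\to}x\Rightarrow \|Ax_n-Ax\|\to 0$. One has $SN(Y)\subset S(Y)\subset L(Y)$. $M(Y)$ is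 the set of linear operators mapping every norm-bounded set to a relatively compact set in the strict topology (equivalently: for every bounded sequence $(x_n)$, $(Ax_n)$ has a strictly convergent subsequence with limit in $Y$). $A\in L(Y)$ is Fredholm if $\dim\ker A<\infty$ and $\dim (Y/A(Y))<\infty$. *)

theory Defs
  imports "HOL-Analysis.Analysis"
begin

text \<open>
  The scalar field is a type of class \<^class>\<open>real_normed_field\<close>; its instances \<^typ>\<open>real\<close> and
  \<^typ>\<open>complex\<close> give real and complex Banach spaces (and, by Gelfand--Mazur, every instance is
  isometrically isomorphic to one of these two). A complex Banach space is a real Banach space
  with an additional multiplication by complex scalars, hence the two compatibility conditions.
\<close>

locale banach_space_over = vector_space scl
  for scl :: "'k::real_normed_field \<Rightarrow> 'a::banach \<Rightarrow> 'a" +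
  assumes norm_scale: "norm (scl c x) = norm c * norm x"
    and scale_of_real: "scl (of_real r) x = r *\<^sub>R x"

lemma banach_space_over_real: "banach_space_over (scaleR :: real \<Rightarrow> 'a::banach \<Rightarrow> 'a)"
  by unfold_locales (auto simp: algebra_simps)

lemma banach_space_over_complex: "banach_space_over ((*) :: complex \<Rightarrow> complex \<Rightarrow> complex)"
  by unfold_locales (auto simp: algebra_simps norm_mult scaleR_conv_of_real)

definition linear_operators :: "('k::real_normed_field \<Rightarrow> 'a::banach \<Rightarrow> 'a) \<Rightarrow> ('a \<Rightarrow> 'a) set"
  where "linear_operators scl = {A. Vector_Spaces.linear scl scl A}"

definition op_L :: "('k::real_normed_field \<Rightarrow> 'a::banach \<Rightarrow> 'a) \<Rightarrow> ('a \<Rightarrow> 'a) set"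
  where "op_L scl = {A \<in> linear_operators scl. \<exists>b. \<forall>x. norm (A x) \<le> b * norm x}"

text \<open>The \<^const>\<open>bdd_above\<close> conjunct is there because \<^const>\<open>Sup\<close> on the reals is unspecified
  for unbounded sets.\<close>

definition projection_sequence ::
  "('k::real_normed_field \<Rightarrow> 'a::banach \<Rightarrow> 'a) \<Rightarrow> (nat \<Rightarrow> 'a \<Rightarrow> 'a) \<Rightarrow> bool"
  where "projection_sequence scl P \<longleftrightarrow>
    (\<forall>n. P n \<in> op_L scl) \<and>
    (\<forall>x. bdd_above (range (\<lambda>n. norm (P n x))) \<and> (SUP n. norm (P n x)) = norm x) \<and>
    (\<forall>m. \<exists>N\<ge>m. \<forall>n\<ge>N. P n \<circ> P m = P m \<and> P m \<circ> P n = P m)"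

definition norm_upto :: "(nat \<Rightarrow> 'a::banach \<Rightarrow> 'a) \<Rightarrow> nat \<Rightarrow> 'a \<Rightarrow> real"
  where "norm_upto P n x = Max ((\<lambda>m. norm (P m x)) ` {0..n})"

definition strict_seminorm :: "(nat \<Rightarrow> 'a::banach \<Rightarrow> 'a) \<Rightarrow> (nat \<Rightarrow> real) \<Rightarrow> 'a \<Rightarrow> real"
  where "strict_seminorm P a x = (SUP n. a n * norm_upto P n x)"

definition strict_topology :: "(nat \<Rightarrow> 'a::banach \<Rightarrow> 'a) \<Rightarrow> 'a topology"
  where "strict_topology P = topology_generated_by
    {{y. strict_seminorm P a (y - x) < e} | a x e. (\<forall>n. 0 < a n) \<and> a \<longlonglongrightarrow> 0 \<and> 0 < e}"

abbreviation strict_convergent ::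
  "(nat \<Rightarrow> 'a::banach \<Rightarrow> 'a) \<Rightarrow> (nat \<Rightarrow> 'a) \<Rightarrow> 'a \<Rightarrow> bool"
  where "strict_convergent P xs x \<equiv> limitin (strict_topology P) xs x sequentially"

definition op_S ::
  "('k::real_normed_field \<Rightarrow> 'a::banach \<Rightarrow> 'a) \<Rightarrow> (nat \<Rightarrow> 'a \<Rightarrow> 'a) \<Rightarrow> ('a \<Rightarrow> 'a) set"
  where "op_S scl P = {A \<in> linear_operators scl.
    \<forall>xs x. strict_convergent P xs x \<longrightarrow> strict_convergent P (\<lambda>n. A (xs n)) (A x)}"

definition op_SN ::
  "('k::real_normed_field \<Rightarrow> 'a::banach \<Rightarrow> 'a) \<Rightarrow> (nat \<Rightarrow> 'a \<Rightarrow> 'a) \<Rightarrow> ('a \<Rightarrow> 'a) set"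
  where "op_SN scl P = {A \<in> linear_operators scl.
    \<forall>xs x. strict_convergent P xs x \<longrightarrow> (\<lambda>n. norm (A (xs n) - A x)) \<longlonglongrightarrow> 0}"

definition op_M ::
  "('k::real_normed_field \<Rightarrow> 'a::banach \<Rightarrow> 'a) \<Rightarrow> (nat \<Rightarrow> 'a \<Rightarrow> 'a) \<Rightarrow> ('a \<Rightarrow> 'a) set"
  where "op_M scl P = {A \<in> linear_operators scl.
    \<forall>X. bounded X \<longrightarrow> compactin (strict_topology P) (strict_topology P closure_of (A ` X))}"

text \<open>
  The quotient by a subspace \<open>U\<close> consists of the cosets \<open>x +o U\<close>. Its zero is \<open>U\<close>, its addition is
  the elementwise sum of sets, and \<open>c\<close> times a coset \<open>Q\<close> is \<open>scl c ` Q + U\<close>, where the summand \<open>U\<close>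
  only matters for \<open>c = 0\<close>.
\<close>

definition quotient_space :: "'a::banach set \<Rightarrow> 'a set set"
  where "quotient_space U = range (\<lambda>x. x +o U)"

definition quotient_subspace ::
  "('k::real_normed_field \<Rightarrow> 'a::banach \<Rightarrow> 'a) \<Rightarrow> 'a set \<Rightarrow> 'a set set \<Rightarrow> bool"
  where "quotient_subspace scl U W \<longleftrightarrow>
    W \<subseteq> quotient_space U \<and> U \<in> W \<and>
    (\<forall>Q\<in>W. \<forall>R\<in>W. Q + R \<in> W) \<and>
    (\<forall>c. \<forall>Q\<in>W. scl c ` Q + U \<in> W)"

definition finite_dim_quotient ::
  "('k::real_normed_field \<Rightarrow> 'a::banach \<Rightarrow> 'a) \<Rightarrow> 'a set \<Rightarrow> bool"
  where "finite_dim_quotient scl U \<longleftrightarrow>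
    (\<exists>B. finite B \<and> B \<subseteq> quotient_space U \<and> quotient_subspace scl U hull B = quotient_space U)"

definition finite_dim_subspace ::
  "('k::real_normed_field \<Rightarrow> 'a::banach \<Rightarrow> 'a) \<Rightarrow> 'a set \<Rightarrow> bool"
  where "finite_dim_subspace scl V \<longleftrightarrow> (\<exists>B. finite B \<and> module.span scl B = V)"

definition fredholm :: "('k::real_normed_field \<Rightarrow> 'a::banach \<Rightarrow> 'a) \<Rightarrow> ('a \<Rightarrow> 'a) \<Rightarrow> bool"
  where "fredholm scl A \<longleftrightarrow> A \<in> op_L scl \<and>
    finite_dim_subspace scl {x. A x = 0} \<and> finite_dim_quotient scl (range A)"

end

theory Submission
  imports Defs
begin

text \<open>
  The operators \<open>T1\<close> and \<open>T2\<close> need not be compact, but composing them with \<open>K\<close> makes them so: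
  \<open>K\<close> sends a bounded sequence to one with a strictly convergent subsequence, \<open>inv C\<close> preserves
  strict convergence, and \<open>T1\<close>, \<open>T2\<close> turn strict convergence into norm convergence. Hence
  \<open>T2 C\<^sup>-\<^sup>1 K\<close> and \<open>T1 K C\<^sup>-\<^sup>1\<close> are compact (\<open>compact_operator_SN_comp\<close>).

  It therefore suffices to replace the parametrix \<open>B\<close> by one whose remainders have these forms,
  and \<open>R = B - T2 C\<^sup>-\<^sup>1\<close> does. On the left,
  \<open>R A = I + T2 - T2 C\<^sup>-\<^sup>1 (C + K) = I - T2 C\<^sup>-\<^sup>1 K\<close>. On the right, comparing the two
  expressions for \<open>A B A\<close> gives \<open>A T2 = T1 A\<close>, so that
  \<open>A R = I + T1 - T1 A C\<^sup>-\<^sup>1 = I - T1 K C\<^sup>-\<^sup>1\<close>. Thus \<open>A\<close> is invertible modulo compact operators,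
  and it is Fredholm by the theorem of Atkinson (\<open>fredholm_if_invertible_modulo_compact\<close>).

  The half of that theorem needed here has a short direct proof
  (\<open>compact_perturbation_finite_codim\<close>): if \<open>G\<close> is compact, the image of the unit ball is within
  distance \<open>1/2\<close> of a finite set \<open>W\<close>, and a geometric series built from this approximation
  writes every vector as an element of the range of \<open>I - G\<close> plus an element of the span of \<open>W\<close>.

  On the topological side, only bounded sequences matter. Strictly convergent sequences are
  bounded (\<open>strict_convergent_imp_bounded\<close>), from which \<open>K\<close> is bounded, and on bounded sequences
  strict convergence is convergence under every \<open>P m\<close> (\<open>strict_convergentI\<close>). The latter turns
  compactness in the strict topology into the extraction of subsequences
  (\<open>bounded_in_strict_compact_imp_subsequence\<close>).
\<close>

section \<open>Convergence in the strict topology\<close>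

locale norming_sequence =
  fixes P :: "nat \<Rightarrow> 'a::banach \<Rightarrow> 'a"
  assumes lin: "linear (P n)"
    and contraction: "norm (P n x) \<le> norm x"
    and norming: "(\<And>n. norm (P n x) \<le> c) \<Longrightarrow> norm x \<le> c"
begin

abbreviation null_weight :: "(nat \<Rightarrow> real) \<Rightarrow> bool"
  where "null_weight a \<equiv> (\<forall>n. 0 < a n) \<and> a \<longlonglongrightarrow> 0"

lemma norm_upto_le_iff: "norm_upto P n x \<le> c \<longleftrightarrow> (\<forall>m\<le>n. norm (P m x) \<le> c)"
  unfolding norm_upto_def by (subst Max_le_iff) auto

lemma norm_le_norm_upto: "m \<le> n \<Longrightarrow> norm (P m x) \<le> norm_upto P n x"
  using norm_upto_le_iff by blast

lemma norm_upto_le_norm: "norm_upto P n x \<le> norm x"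
  by (simp add: norm_upto_le_iff contraction)

lemma norm_upto_nonneg: "0 \<le> norm_upto P n x"
  using norm_le_norm_upto[of n n x] norm_ge_zero order_trans by blast

lemma norm_upto_mono: "m \<le> n \<Longrightarrow> norm_upto P m x \<le> norm_upto P n x"
  by (simp add: norm_upto_le_iff norm_le_norm_upto)

lemma norm_upto_triangle: "norm_upto P n (x + y) \<le> norm_upto P n x + norm_upto P n y"
  unfolding norm_upto_le_iff
  by (metis (no_types, lifting) add_mono linear_add lin norm_le_norm_upto norm_triangle_le)

lemma null_weight_bounded:
  assumes "null_weight a" obtains M where "M > 0" "\<And>n. a n \<le> M"
proof -
  from assms obtain M where "M > 0" "\<And>n. norm (a n) \<le> M"
    by (metis Bseq_def convergentI convergent_imp_Bseq)
  then show thesis using that by (metis abs_le_D1 real_norm_def)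
qed

lemma null_weight_harmonic: "null_weight (\<lambda>n. 1 / (real n + 1))"
  using LIMSEQ_inverse_real_of_nat by (auto simp: inverse_eq_divide add.commute)

lemma strict_seminorm_le:
  assumes "\<And>n. a n * norm_upto P n x \<le> c"
  shows "strict_seminorm P a x \<le> c"
  unfolding strict_seminorm_def by (rule cSUP_least) (use assms in auto)

lemma weighted_norm_upto_le:
  assumes "null_weight a"
  shows "a n * norm_upto P n x \<le> strict_seminorm P a x"
proof -
  obtain M where M: "M > 0" "\<And>n. a n \<le> M" using assms null_weight_bounded by blast
  have "a n * norm_upto P n x \<le> M * norm x" for n
    using M assms norm_upto_nonneg norm_upto_le_norm by (intro mult_mono) (auto intro: less_imp_le)
  then have "bdd_above (range (\<lambda>n. a n * norm_upto P n x))" by (rule bdd_aboveI2)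
  then show ?thesis unfolding strict_seminorm_def by (rule cSUP_upper2) auto
qed

lemma strict_seminorm_nonneg: "null_weight a \<Longrightarrow> 0 \<le> strict_seminorm P a x"
  by (meson less_imp_le mult_nonneg_nonneg norm_upto_nonneg order_trans weighted_norm_upto_le)

lemma strict_seminorm_zero: "null_weight a \<Longrightarrow> strict_seminorm P a 0 = 0"
proof (rule antisym)
  show "strict_seminorm P a 0 \<le> 0"
    using norm_upto_le_norm[of _ 0] norm_upto_nonneg[of _ 0]
    by (intro strict_seminorm_le) (metis antisym mult_zero_right norm_zero order_refl)
qed (rule strict_seminorm_nonneg)

lemma strict_seminorm_triangle:
  assumes "null_weight a"
  shows "strict_seminorm P a (x + y) \<le> strict_seminorm P a x + strict_seminorm P a y"
proof (rule strict_seminorm_le)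
  fix n
  have "a n * norm_upto P n (x + y) \<le> a n * norm_upto P n x + a n * norm_upto P n y"
    using assms norm_upto_triangle[of n x y]
    by (metis distrib_left less_imp_le mult_left_mono)
  then show "a n * norm_upto P n (x + y) \<le> strict_seminorm P a x + strict_seminorm P a y"
    using weighted_norm_upto_le[OF assms, of n x] weighted_norm_upto_le[OF assms, of n y] by linarith
qed

lemma openin_strict_ball:
  "null_weight a \<Longrightarrow> 0 < e \<Longrightarrow> openin (strict_topology P) {y. strict_seminorm P a (y - x) < e}"
  unfolding strict_topology_def by (rule topology_generated_by_Basis) blast

lemma strict_convergent_iff:
  "strict_convergent P xs x \<longleftrightarrow>
    (\<forall>a. null_weight a \<longrightarrow> (\<lambda>n. strict_seminorm P a (xs n - x)) \<longlonglongrightarrow> 0)"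
proof
  assume conv: "strict_convergent P xs x"
  show "\<forall>a. null_weight a \<longrightarrow> (\<lambda>n. strict_seminorm P a (xs n - x)) \<longlonglongrightarrow> 0"
  proof (intro allI impI)
    fix a assume a: "null_weight a"
    show "(\<lambda>n. strict_seminorm P a (xs n - x)) \<longlonglongrightarrow> 0"
    proof (rule tendstoI)
      fix e :: real assume e: "e > 0"
      have "x \<in> {y. strict_seminorm P a (y - x) < e}" using strict_seminorm_zero a e by simp
      with conv openin_strict_ball[OF a e]
      have "\<forall>\<^sub>F n in sequentially. xs n \<in> {y. strict_seminorm P a (y - x) < e}"
        unfolding limitin_def by blast
      then show "\<forall>\<^sub>F n in sequentially. dist (strict_seminorm P a (xs n - x)) 0 < e"
        using strict_seminorm_nonneg[OF a] by (simp add: dist_real_def)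
    qed
  qed
next
  assume semi: "\<forall>a. null_weight a \<longrightarrow> (\<lambda>n. strict_seminorm P a (xs n - x)) \<longlonglongrightarrow> 0"
  let ?S = "{{y. strict_seminorm P a (y - x) < e} | a x e. null_weight a \<and> 0 < e}"
  have top: "strict_topology P = topology_generated_by ?S"
    unfolding strict_topology_def by (rule arg_cong[where f = topology_generated_by]) auto
  have "x \<in> U \<longrightarrow> (\<forall>\<^sub>F n in sequentially. xs n \<in> U)" if "generate_topology_on ?S U" for U
    using that
  proof (induction rule: generate_topology_on.induct)
    case (UN K)
    show ?case
    proof
      assume "x \<in> \<Union>K"
      then obtain k where k: "k \<in> K" "x \<in> k" by blast
      with UN have "\<forall>\<^sub>F n in sequentially. xs n \<in> k" by blast
      then show "\<forall>\<^sub>F n in sequentially. xs n \<in> \<Union>K" by eventually_elim (use k in blast)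
    qed
  next
    case (Basis s)
    then obtain a c e where a: "null_weight a" and s: "s = {y. strict_seminorm P a (y - c) < e}"
      by blast
    show ?case
    proof
      assume "x \<in> s"
      then have "0 < e - strict_seminorm P a (x - c)" by (simp add: s)
      with semi a have "\<forall>\<^sub>F n in sequentially. strict_seminorm P a (xs n - x) < e - strict_seminorm P a (x - c)"
        by (metis order_tendstoD(2))
      then show "\<forall>\<^sub>F n in sequentially. xs n \<in> s"
      proof eventually_elim
        case (elim n)
        have "strict_seminorm P a (xs n - c) \<le> strict_seminorm P a (xs n - x) + strict_seminorm P a (x - c)"
          using strict_seminorm_triangle[OF a, of "xs n - x" "x - c"] by simp
        with elim show ?case by (simp add: s)
      qed
    qed
  qed (auto elim: eventually_elim2)
  moreover have "x \<in> \<Union>?S"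
  proof -
    let ?w = "\<lambda>n. 1 / (real n + 1)"
    have "{y. strict_seminorm P ?w (y - x) < 1} \<in> ?S"
      by (intro CollectI exI[of _ ?w] exI[of _ x] exI[of _ "1::real"] conjI refl)
        (use null_weight_harmonic in simp_all)
    moreover have "x \<in> {y. strict_seminorm P ?w (y - x) < 1}"
      using strict_seminorm_zero[OF null_weight_harmonic] by simp
    ultimately show ?thesis by blast
  qed
  ultimately show "strict_convergent P xs x"
    unfolding limitin_def top openin_topology_generated_by_iff topology_generated_by_topspace by blast
qed

text \<open>
  Put \<open>d m = sup\<^sub>n |x\<^sub>n - x|\<^sub>m\<close>. If the sequence were unbounded, \<open>d\<close> would increase to infinity,
  so \<open>a m = 1 / sqrt (1 + d m)\<close> would be an admissible weight; but the seminorms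
  \<open>|x\<^sub>n - x|\<^sub>a\<close> would then dominate \<open>d m / sqrt (1 + d m)\<close> for every \<open>m\<close> and hence be unbounded.
\<close>

lemma strict_convergent_imp_bounded:
  assumes "strict_convergent P xs x"
  shows "bounded (range xs)"
proof -
  define z where "z n = xs n - x" for n
  have semi: "\<exists>M. \<forall>n. strict_seminorm P a (z n) \<le> M" if "null_weight a" for a
  proof -
    have "Bseq (\<lambda>n. strict_seminorm P a (z n))"
      using assms that strict_convergent_iff unfolding z_def
      by (metis (no_types, lifting) convergentI convergent_imp_Bseq)
    then show ?thesis by (metis Bseq_def abs_le_D1 real_norm_def)
  qed
  define w where "w n = 1 / (real n + 1)" for n
  have w: "null_weight w"
    unfolding w_def by (rule null_weight_harmonic)
  have bdd: "bdd_above (range (\<lambda>n. norm_upto P m (z n)))" for m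
  proof -
    obtain M where M: "\<And>n. strict_seminorm P w (z n) \<le> M" using semi[OF w] by blast
    have "norm_upto P m (z n) \<le> M / w m" for n
    proof -
      have "w m * norm_upto P m (z n) \<le> M"
        using M weighted_norm_upto_le[OF w] order_trans by blast
      then show ?thesis using w by (simp add: field_simps)
    qed
    then show ?thesis by (rule bdd_aboveI2)
  qed
  define d where "d m = (SUP n. norm_upto P m (z n))" for m
  have le_d: "norm_upto P m (z n) \<le> d m" for m n
    unfolding d_def using bdd by (intro cSUP_upper) auto
  have d_nonneg: "0 \<le> d m" for m
    using le_d[of m 0] norm_upto_nonneg[of m "z 0"] by linarith
  have d_mono: "d m \<le> d m'" if "m \<le> m'" for m m'
    unfolding d_def[of m] using le_d norm_upto_mono[OF that] order_trans
    by (intro cSUP_least) (blast, blast)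
  have "\<exists>M. \<forall>m. d m \<le> M"
  proof (rule ccontr)
    assume unb: "\<nexists>M. \<forall>m. d m \<le> M"
    have "filterlim d at_top sequentially"
      unfolding filterlim_at_top eventually_sequentially
      using unb d_mono by (meson le_cases order_trans)
    then have "filterlim (\<lambda>m. sqrt (1 + d m)) at_top sequentially"
      by (intro filterlim_compose[OF sqrt_at_top] filterlim_tendsto_add_at_top[OF tendsto_const])
    then have "(\<lambda>m. inverse (sqrt (1 + d m))) \<longlonglongrightarrow> 0"
      by (rule filterlim_compose[OF tendsto_inverse_0_at_top, rotated]) (rule filterlim_ident)
    moreover have "0 < inverse (sqrt (1 + d m))" for m
      using d_nonneg[of m] by simp
    ultimately have a: "null_weight (\<lambda>m. inverse (sqrt (1 + d m)))" by blast
    then obtain M where M: "\<And>n. strict_seminorm P (\<lambda>m. inverse (sqrt (1 + d m))) (z n) \<le> M"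
      using semi[OF a] by blast
    have "1 + d m \<le> (1 + M)\<^sup>2" for m
    proof -
      define s where "s = sqrt (1 + d m)"
      have s: "s \<ge> 1" "s\<^sup>2 = 1 + d m" using d_nonneg[of m] by (auto simp: s_def)
      have "norm_upto P m (z n) \<le> M * s" for n
      proof -
        have "inverse s * norm_upto P m (z n) \<le> M"
          using M weighted_norm_upto_le[OF a] order_trans unfolding s_def by blast
        then show ?thesis using s by (simp add: field_simps)
      qed
      then have "d m \<le> M * s" unfolding d_def by (intro cSUP_least) auto
      then have "s * s \<le> M * s + 1 * 1" using s(2) by (simp add: power2_eq_square)
      also have "\<dots> \<le> (M + 1) * s" using s(1) by (simp add: algebra_simps)
      finally have "s \<le> M + 1" using s(1) by (metis less_le_trans mult_le_cancel_right not_less zero_less_one)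
      then show ?thesis using s by (metis add.commute order_trans power_mono zero_le_one)
    qed
    then show False using unb by (metis add_le_cancel_left add.commute diff_add_cancel)
  qed
  then obtain M where M: "\<And>m. d m \<le> M" by blast
  have "norm (z n) \<le> M" for n
    by (rule norming) (metis M le_d norm_le_norm_upto order_refl order_trans)
  then have "norm (xs n) \<le> M + norm x" for n
    unfolding z_def by (metis add_le_cancel_right norm_triangle_sub add.commute order_trans)
  then show ?thesis by (auto intro!: boundedI)
qed

text \<open>
  On bounded sets the tail of the weight controls all but finitely many of the \<open>P m\<close>, which is why
  boundedness and convergence under each \<open>P m\<close> suffice.
\<close>

lemma strict_convergentI:
  assumes bd: "bounded (range xs)" and coord: "\<And>m. (\<lambda>n. norm (P m (xs n - x))) \<longlonglongrightarrow> 0"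
  shows "strict_convergent P xs x"
  unfolding strict_convergent_iff
proof (intro allI impI)
  fix a assume a: "null_weight a"
  obtain R where R: "\<And>n. norm (xs n) \<le> R" using bd by (auto simp: bounded_iff)
  define M where "M = R + norm x"
  have M: "norm (xs n - x) \<le> M" for n
    unfolding M_def using R by (metis add_mono norm_triangle_ineq4 order_refl order_trans)
  have M0: "M \<ge> 0" using M[of 0] norm_ge_zero order_trans by blast
  obtain \<alpha> where \<alpha>: "\<alpha> > 0" "\<And>n. a n \<le> \<alpha>" using null_weight_bounded[OF a] by blast
  show "(\<lambda>n. strict_seminorm P a (xs n - x)) \<longlonglongrightarrow> 0"
  proof (rule tendstoI)
    fix e :: real assume e: "e > 0"
    have "(\<lambda>k. a k * M) \<longlonglongrightarrow> 0" using a tendsto_mult_left_zero by blast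
    then obtain N where N: "\<And>k. k \<ge> N \<Longrightarrow> a k * M < e / 2"
      using e order_tendstoD(2)[of "\<lambda>k. a k * M" 0 sequentially "e / 2"]
      by (auto simp: eventually_sequentially)
    have "\<forall>\<^sub>F n in sequentially. \<forall>m\<in>{..<N}. norm (P m (xs n - x)) < e / (2 * \<alpha>)"
      using coord e \<alpha>(1) by (intro eventually_ball_finite ballI order_tendstoD(2)) auto
    then show "\<forall>\<^sub>F n in sequentially. dist (strict_seminorm P a (xs n - x)) 0 < e"
    proof eventually_elim
      case (elim n)
      have "strict_seminorm P a (xs n - x) \<le> e / 2"
      proof (rule strict_seminorm_le)
        fix k
        show "a k * norm_upto P k (xs n - x) \<le> e / 2"
        proof (cases "k < N")
          case True
          then have "norm_upto P k (xs n - x) \<le> e / (2 * \<alpha>)"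
            using elim by (auto simp: norm_upto_le_iff intro: less_imp_le)
          then have "a k * norm_upto P k (xs n - x) \<le> \<alpha> * (e / (2 * \<alpha>))"
            using a \<alpha> norm_upto_nonneg by (intro mult_mono) (auto intro: less_imp_le)
          then show ?thesis using \<alpha>(1) by simp
        next
          case False
          have "a k * norm_upto P k (xs n - x) \<le> a k * M"
            using a M norm_upto_le_norm order_trans by (meson less_imp_le mult_left_mono)
          then show ?thesis using N[of k] False by simp
        qed
      qed
      then show ?case using strict_seminorm_nonneg[OF a, of "xs n - x"] e by (simp add: dist_real_def)
    qed
  qed
qed

lemma norm_convergent_imp_strict_convergent:
  assumes "xs \<longlonglongrightarrow> x"
  shows "strict_convergent P xs x"
proof (rule strict_convergentI)
  show "bounded (range xs)" using assms convergent_imp_bounded by blast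
  have "(\<lambda>n. norm (xs n - x)) \<longlonglongrightarrow> 0" using assms by (simp add: LIM_zero tendsto_norm_zero)
  then show "(\<lambda>n. norm (P m (xs n - x))) \<longlonglongrightarrow> 0" for m
    by (rule Lim_null_comparison[rotated]) (simp add: contraction)
qed

text \<open>
  The strict topology need not be first countable, so a cluster point does not by itself give a
  convergent subsequence. On bounded sequences, however, the single seminorm with weight
  \<open>1 / (n + 1)\<close> already detects strict convergence.
\<close>

lemma bounded_in_strict_compact_imp_subsequence:
  assumes comp: "compactin (strict_topology P) S" and xs: "\<And>n. xs n \<in> S" and bd: "bounded (range xs)"
  obtains r y where "strict_mono (r :: nat \<Rightarrow> nat)" "strict_convergent P (xs \<circ> r) y"
proof -
  define w where "w n = 1 / (real n + 1)" for n
  have w: "null_weight w"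
    unfolding w_def by (rule null_weight_harmonic)
  have "\<exists>y. \<forall>U. openin (strict_topology P) U \<and> y \<in> U \<longrightarrow> infinite {n. xs n \<in> U}"
  proof (rule ccontr)
    assume "\<not> ?thesis"
    then have "\<forall>y. \<exists>U. openin (strict_topology P) U \<and> y \<in> U \<and> finite {n. xs n \<in> U}" by blast
    from choice[OF this] obtain U where U: "\<And>y. openin (strict_topology P) (U y)" "\<And>y. y \<in> U y"
      "\<And>y. finite {n. xs n \<in> U y}" by blast
    have "(\<forall>V\<in>range U. openin (strict_topology P) V) \<and> S \<subseteq> \<Union>(range U)" using U(1,2) by blast
    then obtain F where F: "finite F" "F \<subseteq> range U" "S \<subseteq> \<Union>F"
      using comp unfolding compactin_def by meson
    have "UNIV \<subseteq> (\<Union>V\<in>F. {n. xs n \<in> V})" using xs F(3) by blast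
    moreover have "finite (\<Union>V\<in>F. {n. xs n \<in> V})" using F U(3) by auto
    ultimately show False using finite_subset infinite_UNIV_nat by blast
  qed
  then obtain y where y: "\<And>U. openin (strict_topology P) U \<Longrightarrow> y \<in> U \<Longrightarrow> infinite {n. xs n \<in> U}"
    by blast
  have near: "\<exists>n>N. strict_seminorm P w (xs n - y) < 1 / (real j + 1)" for N j
  proof -
    have "infinite {n. xs n \<in> {v. strict_seminorm P w (v - y) < 1 / (real j + 1)}}"
      using w by (intro y openin_strict_ball) (auto simp: strict_seminorm_zero)
    then show ?thesis using infinite_nat_iff_unbounded by auto
  qed
  have "\<exists>r. \<forall>j. strict_seminorm P w (xs (r j) - y) < 1 / (real j + 1) \<and> r j < r (Suc j)"
    using near by (intro dependent_nat_choice) (blast, metis)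
  then obtain r where r: "\<And>j. strict_seminorm P w (xs (r j) - y) < 1 / (real j + 1)"
    "\<And>j. r j < r (Suc j)" by blast
  have "strict_convergent P (xs \<circ> r) y"
  proof (rule strict_convergentI)
    show "bounded (range (xs \<circ> r))" using bd by (rule bounded_subset) auto
    fix m
    have lim: "(\<lambda>j. w j / w m) \<longlonglongrightarrow> 0" using w tendsto_divide_zero by blast
    show "(\<lambda>j. norm (P m ((xs \<circ> r) j - y))) \<longlonglongrightarrow> 0"
    proof (rule Lim_null_comparison[OF _ lim], rule always_eventually, rule allI)
      fix j
      have "w m * norm (P m (xs (r j) - y)) \<le> w m * norm_upto P m (xs (r j) - y)"
        using w norm_le_norm_upto by (simp add: less_imp_le)
      also have "\<dots> \<le> w j"
        using weighted_norm_upto_le[OF w] r(1)[of j] unfolding w_def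
        by (meson less_imp_le order_trans)
      finally show "norm (norm (P m ((xs \<circ> r) j - y))) \<le> w j / w m"
        using w by (simp add: field_simps)
    qed
  qed
  moreover have "strict_mono r" using r(2) by (simp add: strict_mono_Suc_iff)
  ultimately show thesis using that by blast
qed

text \<open>
  If \<open>norm (A x) > n\<^sup>2 * norm x\<close> were possible for every \<open>n\<close>, then rescaling to norm \<open>1 / n\<close> would give
  a null sequence with unbounded image, although strictly convergent sequences are bounded.
\<close>

lemma strictly_continuous_imp_bounded_linear:
  assumes A: "linear A"
    and cont: "\<And>xs x. strict_convergent P xs x \<Longrightarrow> strict_convergent P (\<lambda>n. A (xs n)) (A x)"
  shows "bounded_linear A"
proof -
  have "\<exists>b. \<forall>x. norm (A x) \<le> b * norm x"
  proof (rule ccontr)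
    assume "\<not> ?thesis"
    then have "\<forall>n. \<exists>x. (real n + 1)\<^sup>2 * norm x < norm (A x)" by (meson not_less)
    then obtain x where x: "\<And>n. (real n + 1)\<^sup>2 * norm (x n) < norm (A (x n))" by metis
    have nz: "norm (x n) > 0" for n using x[of n] linear_0[OF A] by (cases "x n = 0") auto
    define z where "z n = (1 / ((real n + 1) * norm (x n))) *\<^sub>R x n" for n
    have "norm (z n) = 1 / (real n + 1)" for n using nz[of n] by (simp add: z_def)
    then have "(\<lambda>n. norm (z n)) \<longlonglongrightarrow> 0"
      using LIMSEQ_inverse_real_of_nat by (simp add: inverse_eq_divide add.commute)
    then have "z \<longlonglongrightarrow> 0" by (rule tendsto_norm_zero_cancel)
    then have "bounded (range (\<lambda>n. A (z n)))"
      using cont norm_convergent_imp_strict_convergent strict_convergent_imp_bounded by blast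
    then obtain M where M: "\<And>n. norm (A (z n)) \<le> M" by (auto simp: bounded_iff)
    have "real n + 1 < M" for n
    proof -
      have "(real n + 1) * ((real n + 1) * norm (x n)) < norm (A (x n))"
        using x[of n] by (simp add: power2_eq_square mult.assoc)
      then have "real n + 1 < norm (A (x n)) / ((real n + 1) * norm (x n))"
        using nz[of n] by (simp add: pos_less_divide_eq)
      also have "\<dots> = norm (A (z n))"
        using nz[of n] by (simp add: z_def linear_scale[OF A])
      finally show ?thesis using M[of n] by linarith
    qed
    moreover obtain n where "M \<le> real n" using real_arch_simple by blast
    ultimately show False by (metis add_increasing2 leD zero_le_one)
  qed
  then obtain b where "\<And>x. norm (A x) \<le> norm x * b" by (metis mult.commute)
  then show ?thesis using A by (intro bounded_linear_intro[where K = b]) (auto simp: linear_add linear_scale)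
qed

end

section \<open>Compact perturbations of the identity\<close>

definition compact_operator :: "('a::banach \<Rightarrow> 'a) \<Rightarrow> bool"
  where "compact_operator G \<longleftrightarrow> bounded_linear G \<and>
    (\<forall>xs::nat \<Rightarrow> 'a. bounded (range xs) \<longrightarrow> (\<exists>r. strict_mono r \<and> convergent (G \<circ> xs \<circ> r)))"

text \<open>
  The centres of the net are images of points of \<open>V\<close>, so that they stay in any \<open>G\<close>-invariant \<open>V\<close>.
\<close>

lemma compact_operator_half_net:
  assumes "compact_operator G"
  obtains W where "finite W" "W \<subseteq> G ` V" "\<And>x. x \<in> V \<Longrightarrow> norm x \<le> 1 \<Longrightarrow> \<exists>w\<in>W. norm (G x - w) \<le> 1/2"
proof -
  have "Met_TC.mtotally_bounded (G ` (V \<inter> cball 0 1))"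
    unfolding Met_TC.mtotally_bounded_sequentially
  proof (intro conjI allI impI)
    fix s :: "nat \<Rightarrow> 'a" assume "range s \<subseteq> G ` (V \<inter> cball 0 1)"
    then have "\<forall>n. \<exists>x. s n = G x \<and> x \<in> cball 0 1" by blast
    from choice[OF this] obtain xs where xs: "\<And>n. s n = G (xs n)" "\<And>n. xs n \<in> cball 0 1" by blast
    have "bounded (range xs)" using xs(2) by (intro bounded_subset[OF bounded_cball]) blast
    then obtain r where r: "strict_mono r" "convergent (G \<circ> xs \<circ> r)"
      using assms unfolding compact_operator_def by blast
    moreover have "s = G \<circ> xs" using xs(1) by auto
    ultimately show "\<exists>r. strict_mono r \<and> Met_TC.MCauchy (s \<circ> r)"
      using convergent_Cauchy by auto
  qed simp
  then obtain W where W: "finite W" "W \<subseteq> G ` (V \<inter> cball 0 1)" "G ` (V \<inter> cball 0 1) \<subseteq> (\<Union>w\<in>W. ball w (1/2))"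
    unfolding Met_TC.mtotally_bounded_def mball_eq_ball by (meson half_gt_zero zero_less_one)
  have "\<exists>w\<in>W. norm (G x - w) \<le> 1/2" if "x \<in> V" "norm x \<le> 1" for x
  proof -
    have "x \<in> V \<inter> cball 0 1" using that by simp
    then have "G x \<in> (\<Union>w\<in>W. ball w (1/2))" using W(3) by blast
    then obtain w where "w \<in> W" "G x \<in> ball w (1/2)" by blast
    then show ?thesis by (metis dist_commute dist_norm less_imp_le mem_ball)
  qed
  with W(1,2) show thesis by (intro that[of W]) auto
qed

text \<open>
  Successive approximation. A half-net \<open>W\<close> of the image of the unit ball gives
  \<open>y = (y - G y) + c *\<^sub>R w + y'\<close> with \<open>w \<in> W\<close> and \<open>norm y'\<close> at most half the bound \<open>c\<close> on \<open>norm y\<close>.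
  Iterating on the remainder \<open>y'\<close> and summing the two geometric series writes \<open>y\<close> as
  \<open>(x - G x) + s\<close>, where \<open>s\<close> lies in the span of the finite set \<open>W\<close>. The subspace \<open>V\<close> makes the
  same argument serve both for kernels, on which the first summand vanishes, and for cokernels.
\<close>

lemma compact_perturbation_finite_codim:
  assumes G: "compact_operator G" and V: "subspace V" "closed V" and inv: "G ` V \<subseteq> V"
  obtains W where "finite W" "W \<subseteq> V" "\<And>y. y \<in> V \<Longrightarrow> \<exists>x\<in>V. \<exists>s\<in>span W. y = (x - G x) + s"
proof -
  interpret G: bounded_linear G using G unfolding compact_operator_def by blast
  obtain W where W: "finite W" "W \<subseteq> G ` V"
    and net: "\<And>x. x \<in> V \<Longrightarrow> norm x \<le> 1 \<Longrightarrow> \<exists>w\<in>W. norm (G x - w) \<le> 1/2"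
    using compact_operator_half_net[OF G] by blast
  have WV: "W \<subseteq> V" using W(2) inv by blast
  have net_scaled: "\<exists>w\<in>W. norm (G x - c *\<^sub>R w) \<le> c / 2" if x: "x \<in> V" "norm x \<le> c" and c: "0 < c" for x c
  proof -
    have "norm ((1 / c) *\<^sub>R x) \<le> 1" using x c by (simp add: divide_simps)
    moreover have "(1 / c) *\<^sub>R x \<in> V" using x V(1) by (simp add: subspace_scale)
    ultimately obtain w where w: "w \<in> W" "norm (G ((1 / c) *\<^sub>R x) - w) \<le> 1/2" using net by blast
    have "G x - c *\<^sub>R w = c *\<^sub>R (G ((1 / c) *\<^sub>R x) - w)"
      using c by (simp add: G.scaleR scaleR_diff_right)
    then have "norm (G x - c *\<^sub>R w) \<le> c * (1/2)"
      using w(2) c by (metis abs_of_pos mult_left_mono norm_scaleR less_imp_le)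
    then show ?thesis using w(1) by auto
  qed
  have "\<exists>x\<in>V. \<exists>s\<in>span W. y = (x - G x) + s" if yV: "y \<in> V" for y
  proof -
    \<comment> \<open>Any positive bound on the norm of \<open>y\<close> works; adding 1 keeps it positive for \<open>y = 0\<close>.\<close>
    define c where "c k = (norm y + 1) * (1/2) ^ k" for k
    have c_pos: "c k > 0" for k
      using norm_ge_zero[of y] by (simp add: c_def add_nonneg_pos)
    have c_Suc: "c (Suc k) = c k / 2" for k by (simp add: c_def)
    have c_sum: "summable c" unfolding c_def by (intro summable_mult summable_geometric) simp
    obtain u where seq: "\<And>k. (u k \<in> V \<and> norm (u k) \<le> c k \<and> (k = 0 \<longrightarrow> u k = y)) \<and>
      (\<exists>w\<in>W. u (Suc k) = G (u k) - c k *\<^sub>R w)"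
    proof (atomize_elim, rule dependent_nat_choice)
      show "\<exists>x. x \<in> V \<and> norm x \<le> c 0 \<and> (0 = (0::nat) \<longrightarrow> x = y)"
        using yV by (auto simp: c_def)
    next
      fix x k assume x: "x \<in> V \<and> norm x \<le> c k \<and> (k = 0 \<longrightarrow> x = y)"
      then obtain w where w: "w \<in> W" "norm (G x - c k *\<^sub>R w) \<le> c k / 2"
        using net_scaled c_pos by blast
      moreover have "G x - c k *\<^sub>R w \<in> V"
        using x w(1) WV inv V(1) by (intro subspace_diff subspace_scale) auto
      ultimately show "\<exists>x'. (x' \<in> V \<and> norm x' \<le> c (Suc k) \<and> (Suc k = 0 \<longrightarrow> x' = y)) \<and>
          (\<exists>w\<in>W. x' = G x - c k *\<^sub>R w)"
        by (auto simp: c_Suc)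
    qed
    have u: "u k \<in> V" "norm (u k) \<le> c k" "u 0 = y" for k
      using seq[of k] seq[of 0] by auto
    have "\<forall>k. \<exists>w. w \<in> W \<and> u (Suc k) = G (u k) - c k *\<^sub>R w" using seq by blast
    from choice[OF this] obtain w where w: "\<And>k. w k \<in> W" "\<And>k. u (Suc k) = G (u k) - c k *\<^sub>R w k"
      by blast
    define x where "x = (\<Sum>k. u k)"
    have "summable u" using u(2) by (intro summable_comparison_test'[OF c_sum]) auto
    then have x: "u sums x" unfolding x_def by (rule summable_sums)
    have xV: "x \<in> V"
    proof (rule Lim_in_closed_set[OF V(2)])
      show "(\<lambda>n. \<Sum>k<n. u k) \<longlonglongrightarrow> x" using x by (simp add: sums_def)
      show "\<forall>\<^sub>F n in sequentially. (\<Sum>k<n. u k) \<in> V"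
        using u(1) V(1) by (intro always_eventually allI subspace_sum) auto
    qed simp
    have "u \<longlonglongrightarrow> 0" using \<open>summable u\<close> by (rule summable_LIMSEQ_zero)
    then have "(\<lambda>k. u k - u (Suc k)) sums y" using telescope_sums'[of u 0] u(3) by simp
    moreover have "(\<lambda>k. u k - G (u k)) sums (x - G x)" by (intro sums_diff x G.sums)
    ultimately have "(\<lambda>k. (u k - u (Suc k)) - (u k - G (u k))) sums (y - (x - G x))"
      by (rule sums_diff)
    then have s: "(\<lambda>k. c k *\<^sub>R w k) sums (y - (x - G x))" by (simp add: w(2))
    \<comment> \<open>Grouping the terms by the value of \<open>w k\<close> shows that the limit stays in the span.\<close>
    define d where "d v = (\<Sum>k. if w k = v then c k else 0)" for v
    have "(\<lambda>k. if w k = v then c k else 0) sums d v" for v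
      unfolding d_def using c_pos
      by (intro summable_sums summable_comparison_test'[OF c_sum]) (auto simp: less_imp_le abs_of_pos)
    then have "(\<lambda>k. \<Sum>v\<in>W. (if w k = v then c k else 0) *\<^sub>R v) sums (\<Sum>v\<in>W. d v *\<^sub>R v)"
      by (intro sums_sum sums_scaleR_left)
    moreover have "(\<Sum>v\<in>W. (if w k = v then c k else 0) *\<^sub>R v) = c k *\<^sub>R w k" for k
    proof -
      have "(\<Sum>v\<in>W. (if w k = v then c k else 0) *\<^sub>R v) = (\<Sum>v\<in>W. if w k = v then c k *\<^sub>R v else 0)"
        by (intro sum.cong) auto
      then show ?thesis using W(1) w(1) by simp
    qed
    ultimately have "y - (x - G x) = (\<Sum>v\<in>W. d v *\<^sub>R v)" using s sums_unique2 by simp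
    then have "y - (x - G x) \<in> span W" by (simp add: span_sum span_scale span_base)
    then show ?thesis using xV by (intro bexI[of _ x] bexI[of _ "y - (x - G x)"]) auto
  qed
  with W(1) WV show thesis using that by blast
qed

section \<open>The Fredholm property over the given scalars\<close>

context banach_space_over
begin

lemma linear_imp_real_linear:
  assumes "Vector_Spaces.linear scl scl A"
  shows "linear A"
proof -
  interpret A: Vector_Spaces.linear scl scl A by fact
  show ?thesis
    by (rule linearI) (metis A.add, metis A.scale scale_of_real)
qed

lemma op_L_imp_bounded_linear:
  assumes "A \<in> op_L scl"
  shows "bounded_linear A"
proof -
  have "linear A" using assms linear_imp_real_linear by (simp add: op_L_def linear_operators_def)
  moreover obtain b where "\<And>x. norm (A x) \<le> norm x * b"
    using assms by (auto simp: op_L_def mult.commute)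
  ultimately show ?thesis by (intro bounded_linear_intro[where K = b]) (auto simp: linear_add linear_scale)
qed

lemma subspace_imp_real_subspace:
  assumes "subspace S"
  shows "Real_Vector_Spaces.subspace S"
  using assms subspace_0 subspace_add subspace_scale
  by (metis real_vector.subspaceI scale_of_real)

lemma real_span_subset_span: "Real_Vector_Spaces.span W \<subseteq> span W"
  by (intro real_vector.span_minimal span_superset subspace_imp_real_subspace subspace_span)

text \<open>
  The next lemmas translate the set operations that define the quotient into operations on
  representatives, so that subspaces of the quotient pull back to subspaces of the space.
\<close>

lemma coset_add:
  assumes "subspace U"
  shows "(x +o U) + (y +o U) = (x + y) +o U"
proof -
  have "U + U = U"
    using assms subspace_add subspace_0 by (force simp: set_plus_def)
  then show ?thesis by (simp add: set_plus_rearrange)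
qed

lemma coset_scale:
  assumes U: "subspace U"
  shows "scl c ` (x +o U) + U = scl c x +o U"
proof
  show "scl c ` (x +o U) + U \<subseteq> scl c x +o U"
    using U by (auto simp: set_plus_def elt_set_plus_def scale_right_distrib add.assoc
        intro!: bexI subspace_add subspace_scale)
  show "scl c x +o U \<subseteq> scl c ` (x +o U) + U"
  proof
    fix z assume "z \<in> scl c x +o U"
    then obtain v where v: "v \<in> U" "z = scl c x + v" by (auto simp: elt_set_plus_def)
    have "x \<in> x +o U" using subspace_0[OF U] by (force simp: elt_set_plus_def)
    then show "z \<in> scl c ` (x +o U) + U" using v by auto
  qed
qed

lemma coset_zero: "(0 :: 'a) +o U = U" by (auto simp: elt_set_plus_def)

lemma coset_eqI:
  assumes U: "subspace U" and "y - x \<in> U"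
  shows "y +o U = x +o U"
proof -
  have "(y - x) +o U = U"
  proof
    show "(y - x) +o U \<subseteq> U" using assms subspace_add by (auto simp: elt_set_plus_def)
    show "U \<subseteq> (y - x) +o U"
    proof
      fix v assume "v \<in> U"
      then have "v - (y - x) \<in> U" using assms subspace_diff by blast
      then have "(y - x) + (v - (y - x)) \<in> (y - x) +o U" by blast
      then show "v \<in> (y - x) +o U" by simp
    qed
  qed
  then have "x +o U = x +o ((y - x) +o U)" by simp
  also have "\<dots> = y +o U" by (simp only: set_plus_rearrange2) simp
  finally show ?thesis ..
qed

lemma finite_dim_quotientI:
  assumes U: "subspace U" and W: "finite W" and dec: "\<And>y. \<exists>u\<in>U. \<exists>s\<in>span W. y = u + s"
  shows "finite_dim_quotient scl U"
  unfolding finite_dim_quotient_def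
proof (intro exI conjI)
  let ?B = "(\<lambda>w. w +o U) ` W"
  show "finite ?B" using W by simp
  show B: "?B \<subseteq> quotient_space U" by (auto simp: quotient_space_def)
  show "quotient_subspace scl U hull ?B = quotient_space U"
  proof (rule hull_unique[OF B])
    show "quotient_subspace scl U (quotient_space U)"
      unfolding quotient_subspace_def quotient_space_def
    proof (intro conjI ballI allI)
      show "U \<in> range (\<lambda>x. x +o U)" using coset_zero[of U] by (metis rangeI)
    qed (auto simp: coset_add[OF U] coset_scale[OF U])
  next
    fix Q assume BQ: "?B \<subseteq> Q" and Q: "quotient_subspace scl U Q"
    have "subspace {s. s +o U \<in> Q}"
    proof (rule subspaceI)
      show "0 \<in> {s. s +o U \<in> Q}" using Q by (simp add: quotient_subspace_def coset_zero)
    next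
      fix x y assume "x \<in> {s. s +o U \<in> Q}" "y \<in> {s. s +o U \<in> Q}"
      then have "(x +o U) + (y +o U) \<in> Q"
        using Q unfolding quotient_subspace_def by blast
      then show "x + y \<in> {s. s +o U \<in> Q}" by (simp only: coset_add[OF U] mem_Collect_eq)
    next
      fix c x assume "x \<in> {s. s +o U \<in> Q}"
      then have "scl c ` (x +o U) + U \<in> Q"
        using Q unfolding quotient_subspace_def by blast
      then show "scl c x \<in> {s. s +o U \<in> Q}" by (simp only: coset_scale[OF U] mem_Collect_eq)
    qed
    then have span: "span W \<subseteq> {s. s +o U \<in> Q}" using BQ by (intro span_minimal) auto
    show "quotient_space U \<subseteq> Q"
    proof
      fix R assume "R \<in> quotient_space U"
      then obtain y where R: "R = y +o U" by (auto simp: quotient_space_def)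
      obtain u s where us: "u \<in> U" "s \<in> span W" "y = u + s" using dec by blast
      then have "R = s +o U" unfolding R using us by (intro coset_eqI[OF U]) auto
      then show "R \<in> Q" using span us(2) by auto
    qed
  qed
qed

text \<open>
  The left parametrix \<open>R\<close> makes \<open>F\<close> the
  identity on the kernel of \<open>A\<close>, and the right parametrix \<open>S\<close> puts the range of \<open>I - G\<close> inside the
  range of \<open>A\<close>. The real span of a finite set lies in its span over the scalars of the space, so
  finiteness over the reals is enough.
\<close>

lemma fredholm_if_invertible_modulo_compact:
  assumes A: "A \<in> op_L scl"
    and R: "\<And>x. R (A x) = x - F x" and R0: "R 0 = 0" and F: "compact_operator F"
    and S: "\<And>x. A (S x) = x - G x" and G: "compact_operator G"
  shows "fredholm scl A"
proof -
  interpret A: Vector_Spaces.linear scl scl A using A by (simp add: op_L_def linear_operators_def)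
  interpret bA: bounded_linear A using op_L_imp_bounded_linear[OF A] .
  let ?N = "{x. A x = 0}"
  have N: "subspace ?N" by (rule subspaceI) (auto simp: A.add A.scale A.zero)
  have FN: "F x = x" if "x \<in> ?N" for x using R[of x] R0 that by simp
  have closed: "closed ?N"
    by (intro closed_Collect_eq bA.continuous_on continuous_on_id continuous_on_const)
  have inv: "F ` ?N \<subseteq> ?N"
  proof
    fix y assume "y \<in> F ` ?N"
    then obtain x where "x \<in> ?N" "y = F x" by blast
    then show "y \<in> ?N" using FN[of x] by simp
  qed
  obtain W where W: "finite W" "W \<subseteq> ?N"
    "\<And>y. y \<in> ?N \<Longrightarrow> \<exists>x\<in>?N. \<exists>s\<in>Real_Vector_Spaces.span W. y = (x - F x) + s"
    by (rule compact_perturbation_finite_codim[OF F subspace_imp_real_subspace[OF N] closed inv])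
      (rule that)
  have "?N \<subseteq> span W"
  proof
    fix y assume "y \<in> ?N"
    then obtain x s where "x \<in> ?N" "s \<in> Real_Vector_Spaces.span W" "y = (x - F x) + s"
      using W(3) by blast
    then show "y \<in> span W" using FN[of x] real_span_subset_span by auto
  qed
  then have "span W = ?N" using span_minimal[OF W(2) N] by blast
  then have ker: "finite_dim_subspace scl ?N" using W(1) unfolding finite_dim_subspace_def by blast
  obtain W' where W': "finite W'"
    "\<And>y. \<exists>x. \<exists>s\<in>Real_Vector_Spaces.span W'. y = (x - G x) + s"
    using compact_perturbation_finite_codim[OF G, of UNIV] by auto
  have "subspace (range A)"
    using A.subspace_image[OF subspace_UNIV] .
  then have "finite_dim_quotient scl (range A)"
  proof (rule finite_dim_quotientI[OF _ W'(1)])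
    fix y
    obtain x s where "s \<in> Real_Vector_Spaces.span W'" "y = (x - G x) + s" using W'(2) by blast
    then show "\<exists>u\<in>range A. \<exists>s\<in>span W'. y = u + s"
      using S[of x] real_span_subset_span by (metis rangeI subsetD)
  qed
  with A ker show ?thesis by (simp add: fredholm_def)
qed

lemma projection_sequence_imp_norming:
  assumes "projection_sequence scl P"
  shows "norming_sequence P"
proof (rule norming_sequence.intro)
  fix n x
  have P: "P n \<in> op_L scl" using assms by (simp add: projection_sequence_def)
  have bdd: "bdd_above (range (\<lambda>n. norm (P n x)))" and sup: "(SUP n. norm (P n x)) = norm x" for x
    using assms by (auto simp: projection_sequence_def)
  show "linear (P n)"
    using P linear_imp_real_linear by (simp add: op_L_def linear_operators_def)
  show "norm (P n x) \<le> norm x"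
    using cSUP_upper[OF UNIV_I bdd[of x]] by (simp add: sup)
next
  fix x c assume le: "\<And>n. norm (P n x) \<le> c"
  have "(SUP n. norm (P n x)) = norm x" using assms by (simp add: projection_sequence_def)
  moreover have "(SUP n. norm (P n x)) \<le> c" by (rule cSUP_least) (use le in auto)
  ultimately show "norm x \<le> c" by simp
qed

end

section \<open>Compactness obtained from the strict topology\<close>

lemma op_M_bounded_imp_subsequence:
  assumes P: "norming_sequence P" and K: "bounded_linear K" "K \<in> op_M scl P"
    and xs: "bounded (range xs)"
  obtains r y where "strict_mono (r :: nat \<Rightarrow> nat)" "strict_convergent P (\<lambda>n. K (xs (r n))) y"
proof -
  let ?S = "strict_topology P closure_of (K ` range xs)"
  have comp: "compactin (strict_topology P) ?S" using K(2) xs by (simp add: op_M_def)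
  interpret norming_sequence P by fact
  have "K ` range xs \<subseteq> ?S"
    using limitin_topspace[OF norm_convergent_imp_strict_convergent[OF tendsto_const]]
    by (intro closure_of_subset) blast
  moreover have "bounded (range (\<lambda>n. K (xs n)))"
    using bounded_linear_image[OF xs K(1)] by (simp add: image_image)
  ultimately obtain r y where "strict_mono r" "strict_convergent P ((\<lambda>n. K (xs n)) \<circ> r) y"
    using bounded_in_strict_compact_imp_subsequence[OF comp, of "\<lambda>n. K (xs n)"] by blast
  then show thesis using that by (simp add: o_def)
qed

text \<open>
  Operators in \<open>SN\<close> upgrade strict convergence to convergence in norm, so they turn compactness
  for the strict topology into genuine compactness.
\<close>

lemma compact_operator_SN_comp:
  assumes T: "T \<in> op_SN scl P" and bounded: "bounded_linear (\<lambda>x. T (L x))"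
    and L: "\<And>xs. bounded (range xs) \<Longrightarrow>
      \<exists>(r :: nat \<Rightarrow> nat) y. strict_mono r \<and> strict_convergent P (\<lambda>n. L (xs (r n))) y"
  shows "compact_operator (\<lambda>x. T (L x))"
  unfolding compact_operator_def
proof (intro conjI allI impI bounded)
  fix xs :: "nat \<Rightarrow> 'a" assume "bounded (range xs)"
  then obtain r y where r: "strict_mono (r :: nat \<Rightarrow> nat)" "strict_convergent P (\<lambda>n. L (xs (r n))) y"
    using L by blast
  then have "(\<lambda>n. norm (T (L (xs (r n))) - T y)) \<longlonglongrightarrow> 0" using T by (auto simp: op_SN_def)
  then have "(\<lambda>n. T (L (xs (r n)))) \<longlonglongrightarrow> T y"
    by (rule LIM_zero_cancel[OF tendsto_norm_zero_cancel])
  then show "\<exists>r. strict_mono r \<and> convergent ((\<lambda>x. T (L x)) \<circ> xs \<circ> r)"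
    using r(1) by (auto simp: o_def convergent_def)
qed

section \<open>Fredholm criterion\<close>

theorem theorem5p4:
  fixes scl :: "'k::real_normed_field \<Rightarrow> 'a::banach \<Rightarrow> 'a"
    and P :: "nat \<Rightarrow> 'a \<Rightarrow> 'a"
    and A B C K T1 T2 :: "'a \<Rightarrow> 'a"
  assumes "banach_space_over scl"
    and "projection_sequence scl P"
    and "A = (\<lambda>x. C x + K x)"
    and "C \<in> op_L scl" and "bij C" and "inv C \<in> op_L scl" and "inv C \<in> op_S scl P"
    and "K \<in> op_S scl P \<inter> op_M scl P"
    and "B \<in> op_L scl"
    and "T1 \<in> op_SN scl P" and "T2 \<in> op_SN scl P"
    and "A \<circ> B = (\<lambda>x. x + T1 x)"
    and "B \<circ> A = (\<lambda>x. x + T2 x)"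
  shows "fredholm scl A"
proof -
  interpret banach_space_over scl by fact
  have P: "norming_sequence P" using assms(2) by (rule projection_sequence_imp_norming)
  interpret norming_sequence P by fact
  let ?D = "inv C"
  have CD: "C (?D x) = x" and DC: "?D (C x) = x" for x
    using \<open>bij C\<close> by (simp_all add: bij_is_surj surj_f_inv_f bij_is_inj)
  have AB: "A (B x) = x + T1 x" and BA: "B (A x) = x + T2 x" for x
    using assms(12,13) by (auto simp: fun_eq_iff)

  have Cb: "bounded_linear C" and Db: "bounded_linear ?D" and Bb: "bounded_linear B"
    using assms(4,6,9) by (auto intro: op_L_imp_bounded_linear)
  have KM: "K \<in> op_M scl P" and KS: "K \<in> op_S scl P" using assms(8) by auto
  have Kb: "bounded_linear K"
    using KS linear_imp_real_linear
    by (intro strictly_continuous_imp_bounded_linear) (auto simp: op_S_def linear_operators_def)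
  have Ab: "bounded_linear A" unfolding assms(3) using Cb Kb by (rule bounded_linear_add)
  have Alin: "Vector_Spaces.linear scl scl A"
  proof -
    interpret C: Vector_Spaces.linear scl scl C
      using assms(4) by (simp add: op_L_def linear_operators_def)
    interpret K: Vector_Spaces.linear scl scl K
      using KS by (simp add: op_S_def linear_operators_def)
    show ?thesis
      unfolding assms(3)
      by unfold_locales (auto simp: C.add K.add C.scale K.scale scale_right_distrib)
  qed
  have AL: "A \<in> op_L scl"
    using Alin bounded_linear.bounded[OF Ab]
    by (auto simp: op_L_def linear_operators_def mult.commute)
  have "T1 = (\<lambda>x. A (B x) - x)" "T2 = (\<lambda>x. B (A x) - x)" by (auto simp: AB BA)
  then have T1b: "bounded_linear T1" and T2b: "bounded_linear T2"
    by (auto intro!: bounded_linear_sub bounded_linear_ident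
        bounded_linear_compose[OF Ab Bb] bounded_linear_compose[OF Bb Ab])

  have left_compact: "compact_operator (\<lambda>x. T2 (?D (K x)))"
  proof (rule compact_operator_SN_comp[OF assms(11)])
    show "bounded_linear (\<lambda>x. T2 (?D (K x)))"
      by (intro bounded_linear_compose[OF T2b] bounded_linear_compose[OF Db] Kb)
    fix xs :: "nat \<Rightarrow> 'a" assume "bounded (range xs)"
    from op_M_bounded_imp_subsequence[OF P Kb KM this] obtain r y
      where "strict_mono (r :: nat \<Rightarrow> nat)" "strict_convergent P (\<lambda>n. K (xs (r n))) y" .
    then show "\<exists>(r :: nat \<Rightarrow> nat) y. strict_mono r \<and> strict_convergent P (\<lambda>n. ?D (K (xs (r n)))) y"
      using assms(7) by (auto simp: op_S_def)
  qed
  have right_compact: "compact_operator (\<lambda>x. T1 (K (?D x)))"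
  proof (rule compact_operator_SN_comp[OF assms(10)])
    show "bounded_linear (\<lambda>x. T1 (K (?D x)))"
      by (intro bounded_linear_compose[OF T1b] bounded_linear_compose[OF Kb] Db)
    fix xs :: "nat \<Rightarrow> 'a" assume "bounded (range xs)"
    then have "bounded (range (\<lambda>n. ?D (xs n)))"
      using bounded_linear_image[OF _ Db] by (fastforce simp: image_image)
    from op_M_bounded_imp_subsequence[OF P Kb KM this]
    show "\<exists>(r :: nat \<Rightarrow> nat) y. strict_mono r \<and> strict_convergent P (\<lambda>n. K (?D (xs (r n)))) y"
      by metis
  qed

  \<comment> \<open>The correction \<open>T2 C\<^sup>-\<^sup>1\<close> removes \<open>T2\<close> and \<open>T1\<close> from the remainders up to terms with a factor \<open>K\<close>.\<close>
  let ?R = "\<lambda>x. B x - T2 (?D x)"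
  have left: "?R (A x) = x - T2 (?D (K x))" for x
  proof -
    have "?D (A x) = x + ?D (K x)"
      by (simp add: assms(3) DC bounded_linear.linear[OF Db] linear_add)
    then show ?thesis by (simp add: BA bounded_linear.linear[OF T2b] linear_add)
  qed
  have right: "A (?R x) = x - T1 (K (?D x))" for x
  proof -
    \<comment> \<open>Associativity of \<open>A B A\<close> gives \<open>A T2 = T1 A\<close>.\<close>
    have "A (T2 z) = T1 (A z)" for z
    proof -
      have "A z + A (T2 z) = A (B (A z))"
        by (simp add: BA bounded_linear.linear[OF Ab] linear_add)
      then show ?thesis by (simp add: AB)
    qed
    then have "A (T2 (?D x)) = T1 (x + K (?D x))" by (simp add: assms(3) CD)
    then have "A (T2 (?D x)) = T1 x + T1 (K (?D x))"
      by (simp add: bounded_linear.linear[OF T1b] linear_add)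
    then show ?thesis by (simp add: AB bounded_linear.linear[OF Ab] linear_diff)
  qed
  have zero: "?R 0 = 0"
    using bounded_linear.linear[OF Bb] bounded_linear.linear[OF Db] bounded_linear.linear[OF T2b]
    by (simp add: linear_0)
  show ?thesis
    by (rule fredholm_if_invertible_modulo_compact[OF AL left zero left_compact right right_compact])
qed

end
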